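(* Fix $N\ge 3$. Let $\ell(\mathcal{M})$ denote the word length of $\mathcal{M}\in \mathrm{SL}_N(\mathbb{Z})$ with respect to a fixed finite generating set. There exist $C_1,C_2>0$ such that for all $\mathcal{M}\in\mathrm{SL}_N(\mathbb{Z})$ $$C_1\log\|\mathcal{M}\|\ \le\ \ell(\mathcal{M})\ \le\ C_2\log\|\mathcal{M}\|.$$ Moreover, if the generating set is $\{e_{ij}\mid i\ne j\}$, then $C_1$ is independent of $N$ and $C_2\le C_3N^N$ for a constant $C_3>0$ that is independent of $N$.
   Context: For a matrix $\mathcal{M}$ with real entries, $\|\mathcal{M}\|$ denotes the sup-norm, i.e. the maximum of the absolute values of the entries. For $1\le i,j\le N$ with $i\neq j$, $e_{ij}$ denotes the $N\times N$ elementary matrix with $1$'s along the diagonal, $ij$-entry equal to $1$, and all other entries $0$. The word length of a group element with respect to a generating set $X$ is the minimal length of a word in $X\cup X^{-1}$ representing it.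
   Formalization: In the upper bounds, log‖M‖ is replaced by log max(2,‖M‖): as printed the bound fails when ‖M‖ = 1, e.g. for e_12, where log‖M‖ = 0 but the word length is positive; for ‖M‖ ≥ 2 nothing changes. *)

theory Defs
  imports
    Complex_Main
    "HOL-Algebra.Generated_Groups"
    "Jordan_Normal_Form.Determinant"
begin

definition SL :: "nat \<Rightarrow> int mat monoid" where
  "SL N = \<lparr> carrier = {M \<in> carrier_mat N N. det M = 1}, monoid.mult = (*), one = 1\<^sub>m N \<rparr>"

lemma group_SL: "group (SL N)"
proof (rule groupI)
  fix M assume "M \<in> carrier (SL N)"
  then have M: "M \<in> carrier_mat N N" "det M = 1"
    by (auto simp: SL_def)
  have adj: "adj_mat M \<in> carrier_mat N N" "adj_mat M * M = 1\<^sub>m N"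
    using adj_mat[OF M(1)] M(2) by auto
  have "det (adj_mat M) * det M = 1"
    using det_mult[OF adj(1) M(1)] adj(2) by simp
  with M adj show "\<exists>L \<in> carrier (SL N). L \<otimes>\<^bsub>SL N\<^esub> M = \<one>\<^bsub>SL N\<^esub>"
    by (intro bexI[of _ "adj_mat M"]) (auto simp: SL_def)
qed (auto simp: SL_def det_mult[of _ N])

text \<open>
  The sup-norm: the maximum of the absolute values of the entries. It is meant for
  matrices with at least one row and one column, since \<^const>\<open>Max\<close> is unspecified on the
  empty set.
\<close>

definition sup_norm :: "'a :: linordered_idom mat \<Rightarrow> 'a" where
  "sup_norm M = Max (abs ` elements_mat M)"

text \<open>
  \<^term>\<open>addrow_mat N 1 i j\<close> is the identity matrix with \<open>1\<close> added to the entry \<open>(i, j)\<close>.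
  Indices run from \<open>0\<close> to \<open>N - 1\<close>.
\<close>

definition elem_gens :: "nat \<Rightarrow> int mat set" where
  "elem_gens N = {addrow_mat N 1 i j | i j. i < N \<and> j < N \<and> i \<noteq> j}"

lemma elem_gens_subset_SL: "elem_gens N \<subseteq> carrier (SL N)"
  by (auto simp: elem_gens_def SL_def det_addrow_mat)

lemma finite_elem_gens: "finite (elem_gens N)"
  by (rule finite_subset[of _ "(\<lambda>(i, j). addrow_mat N 1 i j) ` ({..<N} \<times> {..<N})"])
     (auto simp: elem_gens_def)

text \<open>
  The minimal length of a word in \<open>X \<union> X\<inverse>\<close> that represents \<open>g\<close>. The value is unspecified
  if no such word exists, so it is meaningful when \<open>X\<close> generates \<open>G\<close>.
\<close>

definition word_length :: "('a, 'b) monoid_scheme \<Rightarrow> 'a set \<Rightarrow> 'a \<Rightarrow> nat" where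
  "word_length G X g =
    (LEAST n. \<exists>w. length w = n \<and> set w \<subseteq> X \<union> m_inv G ` X \<and> foldr (\<otimes>\<^bsub>G\<^esub>) w \<one>\<^bsub>G\<^esub> = g)"

text \<open>
  The upper bounds on the word length are stated with \<open>ln (max 2 (sup_norm M))\<close> in place of
  \<open>ln (sup_norm M)\<close>. The norm of an integer matrix of determinant \<open>1\<close> is a positive
  integer, so the two agree unless the norm is \<open>1\<close>. In that case \<open>ln (sup_norm M) = 0\<close>,
  whereas such a matrix can have positive word length, for instance an elementary matrix,
  and a bound by a multiple of \<open>ln (sup_norm M)\<close> is then false.
\<close>

end

theory Submission
  imports Defs "HOL-Number_Theory.Fib"
begin

text \<open>
  Lower bound: multiplying by a letter multiplies the entries by a bounded factor, by at most
  \<open>2\<close> for an elementary matrix.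

  Upper bound: for \<open>N \<ge> 3\<close> the power \<open>e\<^sub>i\<^sub>k\<^sup>n\<close> has word length \<open>O(log n)\<close>. Indeed, if
  \<open>A = [[2, 1], [1, 1]]\<close> acts on the rows \<open>i\<close>, \<open>j\<close>, conjugation by \<open>A\<close> multiplies
  the \<open>(i, k)\<close> and \<open>(j, k)\<close> entries of \<open>e\<^sub>i\<^sub>k\<^sup>x e\<^sub>j\<^sub>k\<^sup>n\<close>, as a column vector, by \<open>A\<close>, so Horner's
  scheme applied to an expansion of \<open>n\<close> in even-indexed Fibonacci numbers produces
  \<open>e\<^sub>i\<^sub>k\<^sup>x e\<^sub>j\<^sub>k\<^sup>n\<close> for some \<open>x\<close>, and a commutator with \<open>e\<^sub>i\<^sub>j\<close> isolates \<open>e\<^sub>i\<^sub>k\<^sup>n\<close>.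
  The product of the quotients in a run of Euclid's algorithm on two entries of size \<open>\<le> m\<close>
  is bounded by a power of \<open>m\<close>, so the \<open>2 \<times> 2\<close> matrix it produces also costs \<open>O(log m)\<close>,
  and its entries are bounded by \<open>m\<close>. Clearing the last column of a
  \<open>(k + 1) \<times> (k + 1)\<close> matrix by \<open>k\<close> such steps turns a bound \<open>m\<close> on the entries into
  \<open>(2m)\<^sup>k m\<close>, that is, \<open>log (2m)\<close> is multiplied by \<open>k + 1\<close>; hence the cost for
  \<open>k \<times> k\<close> blocks is \<open>O(k\<^sup>k log (2m))\<close>.
\<close>

section \<open>Words in a group\<close>

text \<open>The bound is real and need not be sharp, so logarithmic costs add without rounding. The
  predicate also carries the existence of a word, on which the meaning of \<open>word_length\<close>
  depends.\<close>

definition has_word :: "('a, 'b) monoid_scheme \<Rightarrow> 'a set \<Rightarrow> real \<Rightarrow> 'a \<Rightarrow> bool" where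
  "has_word G X x g \<longleftrightarrow>
    (\<exists>w. real (length w) \<le> x \<and> set w \<subseteq> X \<union> m_inv G ` X \<and> foldr (\<otimes>\<^bsub>G\<^esub>) w \<one>\<^bsub>G\<^esub> = g)"

lemma has_word_mono: "has_word G X x g \<Longrightarrow> x \<le> y \<Longrightarrow> has_word G X y g"
  by (force simp: has_word_def)

lemma has_word_one: "0 \<le> x \<Longrightarrow> has_word G X x \<one>\<^bsub>G\<^esub>"
  by (auto simp: has_word_def intro!: exI[of _ "[]"])

lemma word_length_le:
  assumes "has_word G X x g"
  shows "real (word_length G X g) \<le> x"
proof -
  from assms obtain w where w: "real (length w) \<le> x" "set w \<subseteq> X \<union> m_inv G ` X"
    "foldr (\<otimes>\<^bsub>G\<^esub>) w \<one>\<^bsub>G\<^esub> = g"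
    by (auto simp: has_word_def)
  have "word_length G X g \<le> length w"
    unfolding word_length_def by (rule Least_le) (use w in blast)
  with w(1) show ?thesis
    by linarith
qed

lemma has_word_word_length:
  assumes "has_word G X x g"
  shows "has_word G X (real (word_length G X g)) g"
proof -
  have *: "\<exists>w. length w = word_length G X g \<and> set w \<subseteq> X \<union> m_inv G ` X \<and> foldr (\<otimes>\<^bsub>G\<^esub>) w \<one>\<^bsub>G\<^esub> = g"
    unfolding word_length_def
    by (rule LeastI_ex) (use assms in \<open>auto simp: has_word_def\<close>)
  show ?thesis
    unfolding has_word_def using * by (metis order_refl)
qed

context group
begin

lemma foldr_mult_closed: "set w \<subseteq> carrier G \<Longrightarrow> foldr (\<otimes>) w \<one> \<in> carrier G"
  by (induction w) auto

lemma foldr_mult_append: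
  "set v \<subseteq> carrier G \<Longrightarrow> set w \<subseteq> carrier G \<Longrightarrow>
    foldr (\<otimes>) (v @ w) \<one> = foldr (\<otimes>) v \<one> \<otimes> foldr (\<otimes>) w \<one>"
  by (induction v) (simp_all add: foldr_mult_closed m_assoc del: foldr_append)

lemma letters_subset: "X \<subseteq> carrier G \<Longrightarrow> X \<union> m_inv G ` X \<subseteq> carrier G"
  by auto

lemma has_word_closed: "X \<subseteq> carrier G \<Longrightarrow> has_word G X x g \<Longrightarrow> g \<in> carrier G"
  unfolding has_word_def by (metis foldr_mult_closed letters_subset subset_trans)

lemma has_word_letter: "X \<subseteq> carrier G \<Longrightarrow> g \<in> X \<union> m_inv G ` X \<Longrightarrow> has_word G X 1 g"
  unfolding has_word_def by (rule exI[of _ "[g]"]) auto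

lemma has_word_mult:
  assumes X: "X \<subseteq> carrier G" and "has_word G X x g" "has_word G X y h"
  shows "has_word G X (x + y) (g \<otimes> h)"
proof -
  from assms(2) obtain v where v: "real (length v) \<le> x" "set v \<subseteq> X \<union> m_inv G ` X" "foldr (\<otimes>) v \<one> = g"
    by (auto simp: has_word_def)
  from assms(3) obtain w where w: "real (length w) \<le> y" "set w \<subseteq> X \<union> m_inv G ` X" "foldr (\<otimes>) w \<one> = h"
    by (auto simp: has_word_def)
  have "foldr (\<otimes>) (v @ w) \<one> = g \<otimes> h"
    using v w letters_subset[OF X] by (subst foldr_mult_append) auto
  then show ?thesis
    unfolding has_word_def using v w by (intro exI[of _ "v @ w"]) auto
qed

lemma has_word_inv:
  assumes X: "X \<subseteq> carrier G" and "has_word G X x g"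
  shows "has_word G X x (inv g)"
proof -
  have *: "has_word G X (real (length w)) (inv (foldr (\<otimes>) w \<one>))" if "set w \<subseteq> X \<union> m_inv G ` X" for w
    using that
  proof (induction w)
    case Nil
    then show ?case by (simp add: has_word_one)
  next
    case (Cons a w)
    have "set (a # w) \<subseteq> carrier G"
      using Cons.prems letters_subset[OF X] by (rule subset_trans)
    then have a: "a \<in> carrier G" and w: "foldr (\<otimes>) w \<one> \<in> carrier G"
      by (simp_all add: foldr_mult_closed)
    have "has_word G X 1 (inv a)"
      using Cons.prems X by (intro has_word_letter) auto
    with Cons have "has_word G X (real (length w) + 1) (inv (foldr (\<otimes>) w \<one>) \<otimes> inv a)"
      by (intro has_word_mult X) auto
    then show ?case
      using a w by (simp add: inv_mult_group add.commute)
  qed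
  from assms(2) show ?thesis
    by (auto simp: has_word_def[of G X x g] dest!: * intro: has_word_mono)
qed

text \<open>Change of generators: substituting a word in \<open>X\<close> for every letter from
  \<open>Y\<close> stretches lengths by at most the factor \<open>K\<close>; inverse letters cost
  the same.\<close>

lemma has_word_trans:
  assumes X: "X \<subseteq> carrier G" and Y: "\<And>y. y \<in> Y \<Longrightarrow> has_word G X K y" and K: "K \<ge> 0"
    and "has_word G Y x g"
  shows "has_word G X (K * x) g"
proof -
  have *: "has_word G X (K * real (length w)) (foldr (\<otimes>) w \<one>)" if "set w \<subseteq> Y \<union> m_inv G ` Y" for w
    using that
  proof (induction w)
    case Nil
    then show ?case by (simp add: has_word_one)
  next
    case (Cons a w)
    have "has_word G X K a"
      using Cons.prems Y has_word_inv[OF X] by auto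
    with Cons have "has_word G X (K + K * real (length w)) (a \<otimes> foldr (\<otimes>) w \<one>)"
      by (intro has_word_mult X) auto
    then show ?case
      by (simp add: algebra_simps)
  qed
  from assms(4) obtain w where w: "real (length w) \<le> x" "set w \<subseteq> Y \<union> m_inv G ` Y" "foldr (\<otimes>) w \<one> = g"
    by (auto simp: has_word_def)
  show ?thesis
    using *[OF w(2)] mult_left_mono[OF w(1) K] w(3) by (auto intro: has_word_mono)
qed

lemma has_word_generate:
  assumes X: "X \<subseteq> carrier G" and "g \<in> generate G X"
  shows "\<exists>x. has_word G X x g"
  using assms(2)
proof (induction rule: generate.induct)
  case one
  then show ?case by (auto intro!: exI[of _ 0] has_word_one)
next
  case (incl h)
  then show ?case using has_word_letter[OF X] by blast
next
  case (inv h)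
  then show ?case using has_word_letter[OF X] by blast
next
  case (eng h1 h2)
  then show ?case using has_word_mult[OF X] by blast
qed

end

section \<open>Elementary matrices acting on columns\<close>

lemma SL_simps [simp]:
  "M \<in> carrier (SL N) \<longleftrightarrow> M \<in> carrier_mat N N \<and> det M = 1"
  "monoid.mult (SL N) = (*)" "one (SL N) = 1\<^sub>m N"
  by (auto simp: SL_def)

text \<open>
  Coordinates from \<open>N\<close> on are left fixed, so that an elementary matrix acts as a plain function
  update and identities between actions hold for all \<open>v\<close>.
\<close>

definition act :: "nat \<Rightarrow> int mat \<Rightarrow> (nat \<Rightarrow> int) \<Rightarrow> nat \<Rightarrow> int" where
  "act N M v p = (if p < N then \<Sum>r<N. M $$ (p, r) * v r else v p)"

lemma mult_index_sum:
  fixes A B :: "'a :: comm_semiring_0 mat"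
  shows "A \<in> carrier_mat N N \<Longrightarrow> B \<in> carrier_mat N N \<Longrightarrow> p < N \<Longrightarrow> q < N \<Longrightarrow>
    (A * B) $$ (p, q) = (\<Sum>r<N. A $$ (p, r) * B $$ (r, q))"
  by (simp add: scalar_prod_def atLeast0LessThan)

lemma act_index:
  "A \<in> carrier_mat N N \<Longrightarrow> B \<in> carrier_mat N N \<Longrightarrow> p < N \<Longrightarrow> q < N \<Longrightarrow>
    (A * B) $$ (p, q) = act N A (\<lambda>r. B $$ (r, q)) p"
  by (simp add: mult_index_sum act_def del: index_mult_mat)

lemma act_mult:
  assumes "A \<in> carrier_mat N N" "B \<in> carrier_mat N N"
  shows "act N (A * B) v = act N A (act N B v)"
proof
  fix p
  show "act N (A * B) v p = act N A (act N B v) p"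
  proof (cases "p < N")
    case True
    have "act N (A * B) v p = (\<Sum>r<N. \<Sum>s<N. A $$ (p, s) * B $$ (s, r) * v r)"
      using True assms by (simp add: act_def mult_index_sum sum_distrib_right del: index_mult_mat)
    also have "\<dots> = (\<Sum>s<N. \<Sum>r<N. A $$ (p, s) * B $$ (s, r) * v r)"
      by (rule sum.swap)
    finally show ?thesis
      using True by (simp add: act_def sum_distrib_left mult.assoc)
  qed (simp add: act_def)
qed

lemma act_one: "act N (1\<^sub>m N) v = v"
proof
  fix p
  have "p < N \<Longrightarrow> (\<Sum>r<N. 1\<^sub>m N $$ (p, r) * v r) = (\<Sum>r<N. if r = p then v r else 0)"
    by (intro sum.cong) auto
  then show "act N (1\<^sub>m N) v p = v p"
    by (simp add: act_def)
qed

lemma act_inject: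
  assumes "A \<in> carrier_mat N N" "B \<in> carrier_mat N N" and "\<And>v. act N A v = act N B v"
  shows "A = B"
proof (rule eq_matI)
  fix p q assume pq: "p < dim_row B" "q < dim_col B"
  have *: "M $$ (p, q) = act N M (\<lambda>r. if r = q then 1 else 0) p" if "M \<in> carrier_mat N N" for M
    using that pq assms(2) by (simp add: act_def if_distrib[of "(*) _"] cong: if_cong)
  show "A $$ (p, q) = B $$ (p, q)"
    using *[of A] *[of B] assms by simp
qed (use assms in auto)

lemma act_addrow_mat:
  assumes "i < N" "j < N" "i \<noteq> j"
  shows "act N (addrow_mat N c i j) v = v(i := v i + c * v j)"
proof
  fix p
  have "p < N \<Longrightarrow> (\<Sum>r<N. addrow_mat N c i j $$ (p, r) * v r) =
      (\<Sum>r<N. (if r = p then v r else 0) + (if p = i \<and> r = j then c * v r else 0))"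
    using assms by (intro sum.cong) auto
  then show "act N (addrow_mat N c i j) v p = (v(i := v i + c * v j)) p"
    using assms by (auto simp: act_def sum.distrib)
qed

lemma m_inv_addrow_mat:
  assumes "i < N" "j < N" "i \<noteq> j"
  shows "m_inv (SL N) (addrow_mat N c i j) = addrow_mat N (- c) i j"
  using assms addrow_mat_inv[of i N j "- c"]
  by (intro group.inv_equality[OF group_SL]) (simp_all add: det_addrow_mat)

section \<open>Words in elementary matrices and the maps they induce\<close>

abbreviation elem_word :: "nat \<Rightarrow> real \<Rightarrow> int mat \<Rightarrow> bool" where
  "elem_word N \<equiv> has_word (SL N) (elem_gens N)"

lemmas elem_word_mult =
  group.has_word_mult[OF group_SL elem_gens_subset_SL, simplified SL_simps]
lemmas elem_word_inv =
  group.has_word_inv[OF group_SL elem_gens_subset_SL]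
lemmas elem_word_closed =
  group.has_word_closed[OF group_SL elem_gens_subset_SL]

text \<open>Passing to actions turns matrix identities into equalities of function updates, which
  are checked coordinatewise.\<close>

definition elem_act :: "nat \<Rightarrow> real \<Rightarrow> ((nat \<Rightarrow> int) \<Rightarrow> nat \<Rightarrow> int) \<Rightarrow> bool" where
  "elem_act N x f \<longleftrightarrow> (\<exists>M. elem_word N x M \<and> act N M = f)"

lemma elem_act_mono: "elem_act N x f \<Longrightarrow> x \<le> y \<Longrightarrow> elem_act N y f"
  by (auto simp: elem_act_def intro: has_word_mono)

lemma elem_act_id: "0 \<le> x \<Longrightarrow> elem_act N x (\<lambda>v. v)"
  using has_word_one[of x "SL N" "elem_gens N"] act_one by (auto simp: elem_act_def)

lemma elem_act_comp:
  assumes "elem_act N x f" "elem_act N y g" and "\<And>v. h v = f (g v)"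
  shows "elem_act N (x + y) h"
proof -
  from assms obtain A B where AB: "elem_word N x A" "elem_word N y B" "act N A = f" "act N B = g"
    by (auto simp: elem_act_def)
  then have "act N (A * B) = h"
    using elem_word_closed[OF AB(1)] elem_word_closed[OF AB(2)] assms(3)
    by (intro ext) (simp add: act_mult)
  with AB show ?thesis
    unfolding elem_act_def by (intro exI[of _ "A * B"]) (auto simp: elem_word_mult)
qed

text \<open>Here \<open>h\<close> is \<open>f\<close> composed with the inverse of \<open>g\<close>.
  The right inverse \<open>g'\<close> identifies the action of the inverse matrix, which costs no
  more than \<open>g\<close>.\<close>

lemma elem_act_cancel:
  assumes "elem_act N x f" "elem_act N y g" and "\<And>v. h (g v) = f v" and "\<And>v. g (g' v) = v"
  shows "elem_act N (x + y) h"
proof -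
  from assms obtain A B where AB: "elem_word N x A" "elem_word N y B" "act N A = f" "act N B = g"
    by (auto simp: elem_act_def)
  let ?B = "m_inv (SL N) B"
  have B: "B \<in> carrier (SL N)" and A: "A \<in> carrier (SL N)"
    using AB elem_word_closed by blast+
  have B': "?B \<in> carrier (SL N)"
    using B by (rule group.inv_closed[OF group_SL])
  have inv: "?B * B = 1\<^sub>m N"
    using group.l_inv[OF group_SL B] by simp
  have "act N (A * ?B) v = h v" for v
  proof -
    have "act N ?B v = act N ?B (g (g' v))"
      by (simp add: assms)
    also have "\<dots> = act N (?B * B) (g' v)"
      using B B' AB by (simp add: act_mult)
    finally have "act N ?B v = g' v"
      by (simp add: inv act_one)
    moreover have "f (g' v) = h v"
      by (simp flip: assms(3) add: assms(4))
    ultimately show ?thesis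
      using A B' AB by (simp add: act_mult)
  qed
  moreover have "elem_word N (x + y) (A * ?B)"
    using AB by (intro elem_word_mult elem_word_inv)
  ultimately show ?thesis
    by (auto simp: elem_act_def)
qed

lemma elem_act_unit:
  assumes "i < N" "j < N" "i \<noteq> j" "\<bar>c\<bar> = 1"
  shows "elem_act N 1 (\<lambda>v. v(i := v i + c * v j))"
proof -
  have g: "addrow_mat N 1 i j \<in> elem_gens N"
    using assms by (auto simp: elem_gens_def)
  have "c = 1 \<or> c = -1"
    using assms by auto
  then have "addrow_mat N c i j \<in> elem_gens N \<union> m_inv (SL N) ` elem_gens N"
    using g m_inv_addrow_mat[OF assms(1-3), of 1] by force
  then have "elem_word N 1 (addrow_mat N c i j)"
    by (rule group.has_word_letter[OF group_SL elem_gens_subset_SL])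
  then show ?thesis
    using assms act_addrow_mat by (auto simp: elem_act_def fun_eq_iff)
qed

lemma elem_act_imp_elem_word:
  assumes "M \<in> carrier_mat N N" "elem_act N x (act N M)"
  shows "elem_word N x M"
proof -
  from assms(2) obtain A where A: "elem_word N x A" "act N A = act N M"
    by (auto simp: elem_act_def)
  with elem_word_closed[OF A(1)] assms(1) have "A = M"
    by (intro act_inject) auto
  with A show ?thesis by simp
qed

section \<open>Powers of elementary matrices\<close>

definition even_fib :: "nat \<Rightarrow> int" where "even_fib L = int (fib (2 * L))"
definition odd_fib :: "nat \<Rightarrow> int" where "odd_fib L = int (fib (2 * L + 1))"

lemma even_odd_fib_simps [simp]:
  "even_fib 0 = 0" "odd_fib 0 = 1"
  "even_fib (Suc L) = odd_fib L + even_fib L" "odd_fib (Suc L) = 2 * odd_fib L + even_fib L"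
  by (simp_all add: even_fib_def odd_fib_def)

lemma even_fib_nonneg [simp]: "even_fib L \<ge> 0"
  by (simp add: even_fib_def)

text \<open>This growth is what makes the number of Fibonacci digits logarithmic.\<close>

lemma odd_fib_ge: "odd_fib L \<ge> 2 ^ L"
proof (induction L)
  case (Suc L)
  then show ?case using even_fib_nonneg[of L] by (simp del: even_fib_nonneg)
qed simp

text \<open>A form of Cassini's identity: the determinant of \<open>A^L\<close> is 1. It makes
  \<open>A^L\<close> and its inverse cancel in \<open>elem_act_fib_column\<close>.\<close>

lemma even_odd_fib_det: "odd_fib L * (odd_fib L - even_fib L) - even_fib L * even_fib L = 1"
  by (induction L) (simp_all add: algebra_simps)

text \<open>
  Below \<open>odd_fib L\<close> and \<open>even_fib L\<close> are the entries of the first column of the \<open>L\<close>-th power of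
  \<open>A = [[2, 1], [1, 1]]\<close>, acting on the rows \<open>i\<close> and \<open>j\<close>.
\<close>

lemma elem_act_fib_pow:
  assumes ij: "i < N" "j < N" "i \<noteq> j"
  shows "elem_act N (2 * real L) (\<lambda>v. v(i := (odd_fib L - even_fib L) * v i - even_fib L * v j,
    j := - even_fib L * v i + odd_fib L * v j))" (is "elem_act N _ (?Q L)")
proof (induction L)
  case 0
  then show ?case
    by (simp add: elem_act_id)
next
  case (Suc L)
  \<comment> \<open>\<open>?Q L\<close> is the action of the inverse of \<open>A^L\<close>. One
    factor \<open>A^-1\<close> subtracts row \<open>j\<close> from row \<open>i\<close> and then the
    new row \<open>i\<close> from row \<open>j\<close>.\<close>
  have "elem_act N (2 * real L + (1 + 1)) (?Q (Suc L))"
  proof (rule elem_act_comp[OF Suc elem_act_comp[OF _ _ refl]])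
    show "elem_act N 1 (\<lambda>v. v(j := v j + (-1) * v i))" "elem_act N 1 (\<lambda>v. v(i := v i + (-1) * v j))"
      using ij by (intro elem_act_unit; simp)+
  qed (use ij in \<open>auto simp: fun_eq_iff algebra_simps\<close>)
  then show ?case
    by (simp add: algebra_simps)
qed

text \<open>
  Greedy expansion of \<open>n\<close> in the base of the even-indexed Fibonacci numbers, with digits
  \<open>0\<close>, \<open>1\<close>, \<open>2\<close>: the vector with entries \<open>x\<close>, \<open>n\<close> is a sum of digits times
  \<open>A\<^sup>k\<close> applied to the first unit vector.
\<close>

lemma elem_act_fib_expansion:
  assumes ijk: "i < N" "j < N" "k < N" "i \<noteq> j" "i \<noteq> k" "j \<noteq> k"
    and n: "0 \<le> n" "n < even_fib (Suc L)"
  shows "\<exists>x. elem_act N (4 * real L) (\<lambda>v. v(i := odd_fib L * v i + even_fib L * v j + x * v k,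
    j := even_fib L * v i + (odd_fib L - even_fib L) * v j + n * v k))"
  using n
proof (induction L arbitrary: n)
  case 0
  then have "n = 0" by simp
  then show ?case
    by (intro exI[of _ 0]) (simp add: elem_act_id)
next
  case (Suc L)
  define b where "b = even_fib (Suc L)"
  have "odd_fib L > 0"
    using odd_fib_ge[of L] by (smt (verit) zero_less_power)
  \<comment> \<open>The next base element \<open>even_fib (Suc (Suc L))\<close> is at most
    \<open>3 * b\<close>, which limits the leading digit \<open>e\<close> to 0, 1, 2.\<close>
  then have b: "b > 0" "n < 3 * b"
    using Suc.prems even_fib_nonneg[of L] by (auto simp: b_def simp del: even_fib_nonneg)
  define e where "e = n div b"
  have "b * e < b * 3"
    using b pos_mod_sign[of b n] mult_div_mod_eq[of b n] unfolding e_def by linarith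
  then have "e < 3"
    using b(1) by (simp only: mult_less_cancel_left_pos)
  moreover have "0 \<le> e"
    using b(1) Suc.prems by (simp add: e_def pos_imp_zdiv_nonneg_iff)
  ultimately have e: "e = 0 \<or> e = 1 \<or> e = 2"
    by auto
  have "n mod b < even_fib (Suc L)"
    using pos_mod_bound[OF b(1), of n] unfolding b_def .
  from Suc.IH[OF pos_mod_sign[OF b(1)] this] obtain x where x: "elem_act N (4 * real L)
    (\<lambda>v. v(i := odd_fib L * v i + even_fib L * v j + x * v k,
      j := even_fib L * v i + (odd_fib L - even_fib L) * v j + n mod b * v k))" (is "elem_act N _ ?U")
    by blast
  have one: "elem_act N 1 (\<lambda>v. v(i := v i + 1 * v k))"
    using ijk by (intro elem_act_unit) auto
  have "elem_act N (1 + 1) (\<lambda>v. v(i := v i + 2 * v k))"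
    by (rule elem_act_comp[OF one one]) (use ijk in \<open>auto simp: fun_eq_iff\<close>)
  then have two: "elem_act N 2 (\<lambda>v. v(i := v i + 2 * v k))"
    by simp
  from e have E: "elem_act N 2 (\<lambda>v. v(i := v i + e * v k))"
    using elem_act_mono[OF one] two elem_act_id[of 2 N] by auto
  \<comment> \<open>The digit is applied first, then \<open>A\<close> as two elementary steps, then
    the word for \<open>n mod b\<close>. So \<open>e\<close> enters times the first column of
    \<open>A^(L+1)\<close>, whose lower entry is \<open>b\<close>.\<close>
  have "elem_act N (4 * real L + (1 + (1 + 2)))
    (\<lambda>v. v(i := odd_fib (Suc L) * v i + even_fib (Suc L) * v j + (odd_fib (Suc L) * e + x) * v k,
      j := even_fib (Suc L) * v i + (odd_fib (Suc L) - even_fib (Suc L)) * v j + (b * e + n mod b) * v k))"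
  proof (rule elem_act_comp[OF x elem_act_comp[OF _ elem_act_comp[OF _ E refl] refl]])
    show "elem_act N 1 (\<lambda>v. v(i := v i + 1 * v j))" "elem_act N 1 (\<lambda>v. v(j := v j + 1 * v i))"
      using ijk by (intro elem_act_unit; simp)+
  qed (use ijk in \<open>auto simp: fun_eq_iff algebra_simps b_def\<close>)
  also have "b * e + n mod b = n"
    by (simp add: e_def)
  finally have "elem_act N (4 * real L + (1 + (1 + 2)))
    (\<lambda>v. v(i := odd_fib (Suc L) * v i + even_fib (Suc L) * v j + (odd_fib (Suc L) * e + x) * v k,
      j := even_fib (Suc L) * v i + (odd_fib (Suc L) - even_fib (Suc L)) * v j + n * v k))" .
  then show ?case
    by (intro exI) (erule elem_act_mono, simp)
qed

text \<open>Applying the inverse of \<open>A^L\<close> first removes the linear part on rows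
  \<open>i\<close> and \<open>j\<close>; the column \<open>(x, n)\<close> survives because
  \<open>v k\<close> is not touched.\<close>

lemma elem_act_fib_column:
  assumes ijk: "i < N" "j < N" "k < N" "i \<noteq> j" "i \<noteq> k" "j \<noteq> k"
    and n: "0 \<le> n" "n < even_fib (Suc L)"
  shows "\<exists>x. elem_act N (6 * real L) (\<lambda>v. v(i := v i + x * v k, j := v j + n * v k))"
proof -
  from elem_act_fib_expansion[OF assms] obtain x where x: "elem_act N (4 * real L)
    (\<lambda>v. v(i := odd_fib L * v i + even_fib L * v j + x * v k,
      j := even_fib L * v i + (odd_fib L - even_fib L) * v j + n * v k))" (is "elem_act N _ ?U")
    by blast
  have "elem_act N (4 * real L + 2 * real L) (\<lambda>v. v(i := v i + x * v k, j := v j + n * v k))"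
  proof (rule elem_act_comp[OF x elem_act_fib_pow[OF ijk(1,2,4)]])
    fix v
    let ?d = "odd_fib L * (odd_fib L - even_fib L) - even_fib L * even_fib L"
    let ?w = "v(i := (odd_fib L - even_fib L) * v i - even_fib L * v j,
      j := - even_fib L * v i + odd_fib L * v j)"
    have "?U ?w = v(i := ?d * v i + x * v k, j := ?d * v j + n * v k)"
      using ijk by (auto simp: fun_eq_iff algebra_simps)
    then show "v(i := v i + x * v k, j := v j + n * v k) = ?U ?w"
      by (simp only: even_odd_fib_det mult_1_left)
  qed
  then show ?thesis
    by auto
qed

text \<open>The commutator with \<open>e\<^sub>i\<^sub>j\<close> removes the unwanted coordinate \<open>x\<close>.\<close>

lemma elem_act_elementary_nonneg:
  assumes ijk: "i < N" "j < N" "k < N" "i \<noteq> j" "i \<noteq> k" "j \<noteq> k"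
    and n: "0 \<le> n" "n < even_fib (Suc L)"
  shows "elem_act N (12 * real L + 2) (\<lambda>v. v(i := v i + n * v k))"
proof -
  from elem_act_fib_column[OF assms] obtain x
    where x: "elem_act N (6 * real L) (\<lambda>v. v(i := v i + x * v k, j := v j + n * v k))" (is "elem_act N _ ?u")
    by blast
  have e: "elem_act N 1 (\<lambda>v. v(i := v i + c * v j))" if "\<bar>c\<bar> = 1" for c
    using ijk that by (intro elem_act_unit) auto
  \<comment> \<open>Conjugating \<open>?u\<close> by \<open>e_ij\<close> adds its entry
    \<open>n\<close> in row \<open>j\<close> to its entry \<open>x\<close> in row \<open>i\<close>;
    cancelling \<open>?u\<close> then leaves \<open>n\<close> alone.\<close>
  have "elem_act N (1 + (6 * real L + 1)) (\<lambda>v. ?u (v(i := v i + n * v k)))"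
    by (rule elem_act_comp[OF e[of 1] elem_act_comp[OF x e[of "-1"] refl]])
       (use ijk in \<open>auto simp: fun_eq_iff algebra_simps\<close>)
  then have "elem_act N (1 + (6 * real L + 1) + 6 * real L) (\<lambda>v. v(i := v i + n * v k))"
    by (rule elem_act_cancel[OF _ x, where g' = "\<lambda>v. v(i := v i - x * v k, j := v j - n * v k)"])
       (use ijk in \<open>auto simp: fun_eq_iff algebra_simps\<close>)
  then show ?thesis
    by (simp add: algebra_simps)
qed

lemma elem_act_elementary:
  assumes ik: "i < N" "k < N" "i \<noteq> k" and N: "N \<ge> 3" and c: "\<bar>c\<bar> \<le> m" "1 \<le> m"
  shows "elem_act N (14 * log 2 (2 * real_of_int m)) (\<lambda>v. v(i := v i + c * v k))"
proof -
  \<comment> \<open>The auxiliary row \<open>j\<close> is where \<open>N \<ge> 3\<close>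
    enters.\<close>
  obtain j where j: "j < N" "i \<noteq> j" "j \<noteq> k"
  proof -
    have "\<not> {..<N} \<subseteq> {i, k}"
      using card_mono[of "{i, k}" "{..<N}"] card_insert_le_m1[of 2 "{k}" i] N by auto
    then show ?thesis using that by auto
  qed
  have "nat m \<ge> 1"
    using c by simp
  from ex_power_ivl1[OF order_refl this] obtain L where L: "2 ^ L \<le> nat m" "nat m < 2 ^ (L + 1)"
    by blast
  have "m < 2 ^ (L + 1)"
    using L(2) c by (simp add: nat_less_iff)
  also have "\<dots> \<le> even_fib (Suc (Suc L))"
    using odd_fib_ge[of "L + 1"] even_fib_nonneg[of "L + 1"] by (simp del: even_fib_nonneg)
  finally have m: "m < even_fib (Suc (Suc L))" .
  have "(2::int) ^ L \<le> m"
    using L(1) c by (metis le_nat_iff of_nat_numeral of_nat_power zero_le_one order.trans)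
  then have "(2::real) ^ L \<le> m"
    by (metis of_int_le_iff of_int_numeral of_int_power)
  then have "log 2 (2 ^ (L + 1)) \<le> log 2 (2 * real_of_int m)"
    using c by (subst log_le_cancel_iff) auto
  then have Lm: "real L + 1 \<le> log 2 (2 * real_of_int m)"
    by (subst (asm) log_nat_power) auto
  \<comment> \<open>The cost at index \<open>Suc L\<close> is
    \<open>12 * (L + 1) + 2 \<le> 14 * (L + 1)\<close>. The 2 inside the logarithm keeps it at least
    1, so that it absorbs constants.\<close>
  have nonneg: "elem_act N (14 * log 2 (2 * real_of_int m)) (\<lambda>v. v(i := v i + n * v k))"
    if n: "0 \<le> n" "n \<le> m" for n
  proof -
    have "elem_act N (12 * real (Suc L) + 2) (\<lambda>v. v(i := v i + n * v k))"
      using n m ik j by (intro elem_act_elementary_nonneg[of i N j k]) auto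
    then show ?thesis
      by (rule elem_act_mono) (use Lm in simp)
  qed
  show ?thesis
  proof (cases "c \<ge> 0")
    case True
    with nonneg[of c] c show ?thesis by auto
  next
    case False
    \<comment> \<open>Cancelling against the identity inverts the map for
      \<open>- c\<close>.\<close>
    have "elem_act N (0 + 14 * log 2 (2 * real_of_int m)) (\<lambda>v. v(i := v i + c * v k))"
      by (rule elem_act_cancel[OF elem_act_id nonneg[of "- c"], where g' = "\<lambda>v. v(i := v i + c * v k)"])
         (use False ik c in \<open>auto simp: fun_eq_iff algebra_simps\<close>)
    then show ?thesis by simp
  qed
qed

section \<open>Euclid's algorithm on two rows\<close>

text \<open>Division of absolute values with the signs restored afterwards: \<open>q * b\<close> and
  \<open>r\<close> never have opposite signs, so absolute values add exactly. Both the coefficient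
  bounds and the cost estimate rest on this.\<close>

lemma division_abs:
  fixes a b :: int
  assumes "b \<noteq> 0"
  obtains q r where "a = q * b + r" "\<bar>a\<bar> = \<bar>q\<bar> * \<bar>b\<bar> + \<bar>r\<bar>" "\<bar>r\<bar> < \<bar>b\<bar>"
proof
  let ?q = "sgn a * sgn b * (\<bar>a\<bar> div \<bar>b\<bar>)" and ?r = "sgn a * (\<bar>a\<bar> mod \<bar>b\<bar>)"
  have "a = sgn a * (\<bar>a\<bar> div \<bar>b\<bar> * \<bar>b\<bar> + \<bar>a\<bar> mod \<bar>b\<bar>)"
    by (simp add: mult_sgn_abs)
  also have "\<dots> = ?q * b + ?r"
    by (simp add: distrib_left abs_sgn[of b] mult_ac)
  finally show "a = ?q * b + ?r" .
  have "a = 0 \<or> \<bar>sgn a\<bar> = 1" "\<bar>sgn b\<bar> = 1"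
    using assms by (auto simp: sgn_if)
  then show "\<bar>a\<bar> = \<bar>?q\<bar> * \<bar>b\<bar> + \<bar>?r\<bar>" "\<bar>?r\<bar> < \<bar>b\<bar>"
    using assms by (auto simp: abs_mult pos_imp_zdiv_nonneg_iff)
qed

text \<open>The determinant-one substitute for swapping two rows.\<close>

lemma elem_act_rotate:
  assumes ij: "i < N" "j < N" "i \<noteq> j"
  shows "elem_act N 3 (\<lambda>v. v(i := v j, j := - v i))"
proof -
  have "elem_act N (1 + (1 + 1)) (\<lambda>v. v(i := v j, j := - v i))"
  proof (rule elem_act_comp[OF _ elem_act_comp[OF _ _ refl]])
    show "elem_act N 1 (\<lambda>v. v(i := v i + 1 * v j))"
      "elem_act N 1 (\<lambda>v. v(j := v j + (-1) * v i))"
      "elem_act N 1 (\<lambda>v. v(i := v i + 1 * v j))"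
      using ij by (intro elem_act_unit; simp)+
  qed (use ij in \<open>auto simp: fun_eq_iff\<close>)
  then show ?thesis by simp
qed

lemma elem_act_minus:
  assumes ij: "i < N" "j < N" "i \<noteq> j"
  shows "elem_act N 6 (\<lambda>v. v(i := - v i, j := - v j))"
proof -
  have "elem_act N (3 + 3) (\<lambda>v. v(i := - v i, j := - v j))"
    by (rule elem_act_comp[OF elem_act_rotate[OF ij] elem_act_rotate[OF ij]]) (use ij in \<open>auto simp: fun_eq_iff\<close>)
  then show ?thesis by simp
qed

text \<open>
  The bounds of \<open>s\<close>, \<open>u\<close> by \<open>b\<close> and of \<open>t\<close>, \<open>w\<close> by \<open>a\<close>, and the clause for
  \<open>b = 0\<close>, make the bounds stable under a division step.
\<close>

definition euclid_bounds :: "int \<Rightarrow> int \<Rightarrow> int \<Rightarrow> int \<Rightarrow> int \<Rightarrow> int \<Rightarrow> bool" where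
  "euclid_bounds a b s t u w \<longleftrightarrow> s * a + t * b = gcd a b \<and> u * a + w * b = 0 \<and>
    \<bar>s\<bar> \<le> max 1 \<bar>b\<bar> \<and> \<bar>u\<bar> \<le> max 1 \<bar>b\<bar> \<and> \<bar>t\<bar> \<le> max 1 \<bar>a\<bar> \<and> \<bar>w\<bar> \<le> max 1 \<bar>a\<bar> \<and>
    (b = 0 \<longrightarrow> t = 0 \<and> u = 0)"

lemma euclid_boundsD:
  assumes "euclid_bounds a b s t u w"
  shows "s * a + t * b = gcd a b" "u * a + w * b = 0"
  using assms by (simp_all add: euclid_bounds_def)

lemma euclid_bounds_le:
  assumes eb: "euclid_bounds a b s t u w" and m: "\<bar>a\<bar> \<le> m" "\<bar>b\<bar> \<le> m" "1 \<le> m"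
  shows "\<bar>s\<bar> \<le> m" "\<bar>t\<bar> \<le> m" "\<bar>u\<bar> \<le> m" "\<bar>w\<bar> \<le> m"
proof -
  have "max 1 \<bar>a\<bar> \<le> m" "max 1 \<bar>b\<bar> \<le> m"
    using m by auto
  then show "\<bar>s\<bar> \<le> m" "\<bar>t\<bar> \<le> m" "\<bar>u\<bar> \<le> m" "\<bar>w\<bar> \<le> m"
    using eb unfolding euclid_bounds_def by (meson order.trans)+
qed

text \<open>Division and rotation take \<open>(a, b)\<close> to \<open>(b, - r)\<close>. The new
  coefficients are at most \<open>\<bar>r\<bar> + \<bar>q\<bar> * \<bar>b\<bar> =
  \<bar>a\<bar>\<close>; for \<open>r = 0\<close>, where \<open>s\<close> is only bounded by 1, the
  clause \<open>t = 0 \<and> u = 0\<close> keeps the estimate.\<close>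

lemma euclid_bounds_step:
  assumes eb: "euclid_bounds b (- r) s t u w" and b: "b \<noteq> 0"
    and a: "a = q * b + r" "\<bar>a\<bar> = \<bar>q\<bar> * \<bar>b\<bar> + \<bar>r\<bar>"
  shows "euclid_bounds a b (- t) (s + q * t) (- w) (u + q * w)"
proof -
  have eq: "s * b - t * r = gcd b r" "u * b - w * r = 0"
    and bd: "\<bar>s\<bar> \<le> max 1 \<bar>r\<bar>" "\<bar>u\<bar> \<le> max 1 \<bar>r\<bar>" "\<bar>t\<bar> \<le> \<bar>b\<bar>" "\<bar>w\<bar> \<le> \<bar>b\<bar>"
    and r0: "r = 0 \<Longrightarrow> t = 0 \<and> u = 0"
    using eb b by (auto simp: euclid_bounds_def)
  have "gcd a b = gcd b r"
    unfolding a(1) by (metis gcd.commute gcd_add_mult)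
  have q: "\<bar>q * x\<bar> \<le> \<bar>q\<bar> * \<bar>b\<bar>" if "\<bar>x\<bar> \<le> \<bar>b\<bar>" for x
    using that by (simp add: abs_mult mult_left_mono)
  have "\<bar>s + q * t\<bar> \<le> max 1 \<bar>a\<bar> \<and> \<bar>u + q * w\<bar> \<le> max 1 \<bar>a\<bar>"
  proof (cases "r = 0")
    case True
    then show ?thesis
      using r0 bd q[of w] a(2) by (auto simp: le_max_iff_disj)
  next
    case False
    then have "\<bar>s\<bar> \<le> \<bar>r\<bar>" "\<bar>u\<bar> \<le> \<bar>r\<bar>"
      using bd by auto
    then have "\<bar>s + q * t\<bar> \<le> \<bar>a\<bar>" "\<bar>u + q * w\<bar> \<le> \<bar>a\<bar>"
      unfolding a(2) using q[OF bd(3)] q[OF bd(4)] by linarith+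
    then show ?thesis
      by (simp add: le_max_iff_disj)
  qed
  moreover have "- t * a + (s + q * t) * b = gcd a b" "- w * a + (u + q * w) * b = 0"
  proof -
    have "- t * a + (s + q * t) * b = s * b - t * r" "- w * a + (u + q * w) * b = u * b - w * r"
      by (simp_all add: a(1) algebra_simps)
    then show "- t * a + (s + q * t) * b = gcd a b" "- w * a + (u + q * w) * b = 0"
      using eq \<open>gcd a b = gcd b r\<close> by simp_all
  qed
  ultimately show ?thesis
    using bd b unfolding euclid_bounds_def by (simp add: le_max_iff_disj)
qed

text \<open>Since \<open>(\<bar>q\<bar> + 1) * \<bar>r\<bar> \<le> \<bar>a\<bar>\<close>, the
  logarithm of the product drops by at least 1 and at least \<open>log 2 \<bar>q\<bar>\<close>,
  whence 31 = 17 + 14. The 17 is 3 for the rotation plus 14 for the 2 inside the logarithm.\<close>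

lemma log_euclid_step:
  fixes a b q r :: int
  assumes a: "\<bar>a\<bar> = \<bar>q\<bar> * \<bar>b\<bar> + \<bar>r\<bar>" and r: "r \<noteq> 0" "\<bar>r\<bar> < \<bar>b\<bar>" and q: "q \<noteq> 0"
  shows "17 + 14 * log 2 \<bar>q\<bar> + 31 * log 2 (\<bar>b\<bar> * \<bar>r\<bar>) \<le> 31 * log 2 (\<bar>a\<bar> * \<bar>b\<bar>)"
proof -
  have q1: "\<bar>q\<bar> \<ge> 1" and r1: "\<bar>r\<bar> \<ge> 1"
    using q r by auto
  have "(\<bar>q\<bar> + 1) * \<bar>r\<bar> \<le> \<bar>q\<bar> * \<bar>b\<bar> + \<bar>r\<bar>"
    using r by (simp add: distrib_right mult_left_mono)
  then have le: "(\<bar>q\<bar> + 1) * \<bar>r\<bar> \<le> \<bar>a\<bar>"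
    using a by simp
  have "0 < (\<bar>q\<bar> + 1) * \<bar>r\<bar>"
    using q1 r1 by (intro mult_pos_pos) auto
  then have a1: "0 < \<bar>a\<bar>"
    using le by linarith
  have "real_of_int ((\<bar>q\<bar> + 1) * \<bar>r\<bar>) \<le> real_of_int \<bar>a\<bar>"
    using le by (simp only: of_int_le_iff)
  then have "log 2 ((real_of_int \<bar>q\<bar> + 1) * real_of_int \<bar>r\<bar>) \<le> log 2 (real_of_int \<bar>a\<bar>)"
    using q1 r1 a1 by (subst log_le_cancel_iff) (auto intro!: mult_pos_pos)
  then have A: "log 2 (real_of_int \<bar>q\<bar> + 1) + log 2 (real_of_int \<bar>r\<bar>) \<le> log 2 (real_of_int \<bar>a\<bar>)"
    using q1 r1 by (subst (asm) log_mult_pos) auto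
  have "log 2 2 \<le> log 2 (real_of_int \<bar>q\<bar> + 1)" "log 2 (real_of_int \<bar>q\<bar>) \<le> log 2 (real_of_int \<bar>q\<bar> + 1)"
    using q1 by (subst log_le_cancel_iff; simp)+
  moreover have "log 2 (real_of_int \<bar>a\<bar> * real_of_int \<bar>b\<bar>) = log 2 (real_of_int \<bar>a\<bar>) + log 2 (real_of_int \<bar>b\<bar>)"
    "log 2 (real_of_int \<bar>b\<bar> * real_of_int \<bar>r\<bar>) = log 2 (real_of_int \<bar>b\<bar>) + log 2 (real_of_int \<bar>r\<bar>)"
    using a1 r by (subst log_mult_pos; simp)+
  ultimately show ?thesis
    using A by simp
qed

text \<open>The potential \<open>\<bar>a\<bar> * \<bar>b\<bar>\<close> makes the costs of the
  divisions telescope to a single logarithm. The final division has \<open>r = 0\<close> and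
  accounts for the constant 23 = 6 + 3 + 14.\<close>

lemma elem_act_euclid_ordered:
  assumes ij: "i < N" "j < N" "i \<noteq> j" and N: "N \<ge> 3" and "\<bar>b\<bar> \<le> \<bar>a\<bar>"
  shows "\<exists>s t u w. euclid_bounds a b s t u w \<and>
    elem_act N (if b = 0 then 6 else 23 + 31 * log 2 (\<bar>a\<bar> * \<bar>b\<bar>))
      (\<lambda>v. v(i := s * v i + t * v j, j := u * v i + w * v j))"
  using assms(5)
proof (induction "nat \<bar>b\<bar>" arbitrary: a b rule: less_induct)
  case less
  show ?case
  proof (cases "b = 0")
    case True
    show ?thesis
    proof (cases "a \<ge> 0")
      case True
      then show ?thesis
        using \<open>b = 0\<close> elem_act_id[of 6 N]
        by - (rule exI[of _ 1], rule exI[of _ 0], rule exI[of _ 0], rule exI[of _ 1],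
          simp add: euclid_bounds_def)
    next
      case False
      then show ?thesis
        using \<open>b = 0\<close> elem_act_minus[OF ij]
        by - (rule exI[of _ "-1"], rule exI[of _ 0], rule exI[of _ 0], rule exI[of _ "-1"],
          simp add: euclid_bounds_def)
    qed
  next
    case False
    then obtain q r where qr: "a = q * b + r" "\<bar>a\<bar> = \<bar>q\<bar> * \<bar>b\<bar> + \<bar>r\<bar>" "\<bar>r\<bar> < \<bar>b\<bar>"
      by (rule division_abs)
    have q: "q \<noteq> 0"
      using qr less.prems by auto
    have "\<exists>s t u w. euclid_bounds b (- r) s t u w \<and>
      elem_act N (if r = 0 then 6 else 23 + 31 * log 2 (\<bar>b\<bar> * \<bar>r\<bar>))
        (\<lambda>v. v(i := s * v i + t * v j, j := u * v i + w * v j))"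
    proof -
      have "nat \<bar>- r\<bar> < nat \<bar>b\<bar>" "\<bar>- r\<bar> \<le> \<bar>b\<bar>"
        using qr(3) by auto
      from less.hyps[OF this] show ?thesis
        by (simp only: abs_minus_cancel neg_equal_0_iff_equal)
    qed
    then obtain s t u w where V: "euclid_bounds b (- r) s t u w"
      "elem_act N (if r = 0 then 6 else 23 + 31 * log 2 (\<bar>b\<bar> * \<bar>r\<bar>))
        (\<lambda>v. v(i := s * v i + t * v j, j := u * v i + w * v j))" (is "elem_act N ?x ?V")
      by blast
    have E: "elem_act N (14 * log 2 (2 * real_of_int \<bar>q\<bar>)) (\<lambda>v. v(i := v i + (- q) * v j))"
      using ij N q by (intro elem_act_elementary) auto
    have "elem_act N (?x + (3 + 14 * log 2 (2 * real_of_int \<bar>q\<bar>)))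
      (\<lambda>v. v(i := (- t) * v i + (s + q * t) * v j, j := (- w) * v i + (u + q * w) * v j))"
      by (rule elem_act_comp[OF V(2) elem_act_comp[OF elem_act_rotate[OF ij] E refl]])
         (use ij in \<open>auto simp: fun_eq_iff algebra_simps\<close>)
    moreover have "?x + (3 + 14 * log 2 (2 * real_of_int \<bar>q\<bar>)) \<le> 23 + 31 * log 2 (\<bar>a\<bar> * \<bar>b\<bar>)"
    proof -
      have *: "log 2 (2 * real_of_int \<bar>q\<bar>) = 1 + log 2 \<bar>q\<bar>"
        using q by (subst log_mult_pos) auto
      show ?thesis
      proof (cases "r = 0")
        case True
        have "\<bar>q\<bar> * 1 \<le> \<bar>q\<bar> * \<bar>b\<bar>" "\<bar>q\<bar> * \<bar>b\<bar> * 1 \<le> \<bar>q\<bar> * \<bar>b\<bar> * \<bar>b\<bar>"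
          using False by (intro mult_left_mono; simp)+
        then have "\<bar>q\<bar> \<le> \<bar>a\<bar> * \<bar>b\<bar>"
          using True qr(2) by simp
        then have "real_of_int \<bar>q\<bar> \<le> real_of_int (\<bar>a\<bar> * \<bar>b\<bar>)"
          by (simp only: of_int_le_iff)
        then have "log 2 \<bar>q\<bar> \<le> log 2 (\<bar>a\<bar> * \<bar>b\<bar>)"
          using q False less.prems by (subst log_le_cancel_iff) auto
        moreover have "log 2 \<bar>q\<bar> \<ge> 0"
          using q by simp
        ultimately show ?thesis
          using True unfolding * by simp
      next
        case False
        with log_euclid_step[OF qr(2) False qr(3) q] show ?thesis
          unfolding * by simp
      qed
    qed
    ultimately have "elem_act N (23 + 31 * log 2 (\<bar>a\<bar> * \<bar>b\<bar>))
      (\<lambda>v. v(i := (- t) * v i + (s + q * t) * v j, j := (- w) * v i + (u + q * w) * v j))"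
      by (rule elem_act_mono)
    with euclid_bounds_step[OF V(1) False qr(1,2)] False show ?thesis
      by (simp only: if_False) blast
  qed
qed

text \<open>If the second entry is larger in absolute value, one rotation leads to the ordered pair
  \<open>(b, - a)\<close>. The product of the entries is at most \<open>m^2\<close>, so 31 doubles
  to 62.\<close>

lemma elem_act_gcd:
  assumes ij: "i < N" "j < N" "i \<noteq> j" and N: "N \<ge> 3"
    and m: "\<bar>a\<bar> \<le> m" "\<bar>b\<bar> \<le> m" "1 \<le> m"
  obtains s t u w where "s * a + t * b = gcd a b" "u * a + w * b = 0"
    "\<bar>s\<bar> \<le> m" "\<bar>t\<bar> \<le> m" "\<bar>u\<bar> \<le> m" "\<bar>w\<bar> \<le> m"
    "elem_act N (62 * log 2 (2 * real_of_int m))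
      (\<lambda>v. v(i := s * v i + t * v j, j := u * v i + w * v j))"
proof -
  define l where "l = log 2 (real_of_int m)"
  have l: "l \<ge> 0" "log 2 (2 * real_of_int m) = 1 + l"
    using m unfolding l_def by (auto, subst log_mult_pos, auto)
  have cost: "(if b = 0 then 6 else 23 + 31 * log 2 (\<bar>a\<bar> * \<bar>b\<bar>)) \<le> 23 + 62 * l"
    if "\<bar>a\<bar> \<le> m" "\<bar>b\<bar> \<le> m" "\<bar>b\<bar> \<le> \<bar>a\<bar>" for a b :: int
  proof (cases "b = 0")
    case True
    then show ?thesis using l by simp
  next
    case False
    then have "log 2 (real_of_int \<bar>a\<bar>) \<le> l" "log 2 (real_of_int \<bar>b\<bar>) \<le> l"
      unfolding l_def using that by (subst log_le_cancel_iff; auto)+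
    moreover have "log 2 (real_of_int \<bar>a\<bar> * real_of_int \<bar>b\<bar>) = log 2 (real_of_int \<bar>a\<bar>) + log 2 (real_of_int \<bar>b\<bar>)"
      using False that by (subst log_mult_pos) auto
    ultimately show ?thesis
      using False by simp
  qed
  show thesis
  proof (cases "\<bar>b\<bar> \<le> \<bar>a\<bar>")
    case True
    from elem_act_euclid_ordered[OF ij N this] obtain s t u w where
      V: "euclid_bounds a b s t u w" "elem_act N (if b = 0 then 6 else 23 + 31 * log 2 (\<bar>a\<bar> * \<bar>b\<bar>))
      (\<lambda>v. v(i := s * v i + t * v j, j := u * v i + w * v j))"
      by blast
    have "elem_act N (62 * log 2 (2 * real_of_int m))
      (\<lambda>v. v(i := s * v i + t * v j, j := u * v i + w * v j))"
      by (rule elem_act_mono[OF V(2)], rule order.trans[OF cost[OF m(1,2) True]]) (use l in simp)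
    then show thesis
      using euclid_boundsD[OF V(1)] euclid_bounds_le[OF V(1) m] by (intro that[of s t u w])
  next
    case False
    then have ba: "\<bar>- a\<bar> \<le> \<bar>b\<bar>" by simp
    from elem_act_euclid_ordered[OF ij N this] obtain s t u w where
      V: "euclid_bounds b (- a) s t u w" "elem_act N (if - a = 0 then 6 else 23 + 31 * log 2 (\<bar>b\<bar> * \<bar>- a\<bar>))
      (\<lambda>v. v(i := s * v i + t * v j, j := u * v i + w * v j))"
      by blast
    have "elem_act N (23 + 62 * l + 3)
      (\<lambda>v. v(i := (- t) * v i + s * v j, j := (- w) * v i + u * v j))"
      by (rule elem_act_comp[OF elem_act_mono[OF V(2)] elem_act_rotate[OF ij]])
         (use cost[of b "- a"] m ba ij in \<open>auto simp: fun_eq_iff\<close>)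
    then have "elem_act N (62 * log 2 (2 * real_of_int m))
      (\<lambda>v. v(i := (- t) * v i + s * v j, j := (- w) * v i + u * v j))"
      by (rule elem_act_mono) (use l in linarith)
    then show thesis
      using euclid_boundsD[OF V(1)] euclid_bounds_le[OF V(1), of m] m
      by (intro that[of "- t" s "- w" u]) (simp_all only: abs_minus_cancel gcd.commute gcd_neg2_int mult_minus_left mult_minus_right add.commute)
  qed
qed

section \<open>Elimination\<close>

text \<open>Within \<open>SL N\<close> this is the upper left copy of \<open>SL k\<close>. The
  dimension stays \<open>N\<close>, so a third row is available even when
  \<open>k < 3\<close>.\<close>

definition upper_block :: "nat \<Rightarrow> nat \<Rightarrow> int mat \<Rightarrow> bool" where
  "upper_block N k M \<longleftrightarrow>
    (\<forall>p<N. \<forall>q<N. k \<le> p \<or> k \<le> q \<longrightarrow> M $$ (p, q) = (if p = q then 1 else 0))"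

definition entries_le :: "nat \<Rightarrow> int \<Rightarrow> int mat \<Rightarrow> bool" where
  "entries_le N m M \<longleftrightarrow> (\<forall>p<N. \<forall>q<N. \<bar>M $$ (p, q)\<bar> \<le> m)"

lemma gcd_le_bound:
  fixes a b m :: int
  assumes "\<bar>a\<bar> \<le> m" "\<bar>b\<bar> \<le> m"
  shows "gcd a b \<le> m"
proof (cases "a = 0 \<and> b = 0")
  case False
  then show ?thesis
    using gcd_le1_int[of "\<bar>a\<bar>" "\<bar>b\<bar>"] gcd_le2_int[of "\<bar>b\<bar>" "\<bar>a\<bar>"] assms by fastforce
qed (use assms in auto)

text \<open>Step \<open>j\<close> runs Euclid on rows \<open>k\<close> and \<open>j\<close>. The
  pivot is then a gcd and row \<open>j\<close> is still original, so both inputs are at most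
  \<open>m\<close> and every step costs the same, although other entries grow by a factor
  \<open>2 * m\<close> each time.\<close>

lemma clear_column:
  assumes N: "N \<ge> 3" and k: "k < N" and M: "M \<in> carrier (SL N)" "upper_block N (Suc k) M"
    and m: "entries_le N m M" "1 \<le> m" and "j \<le> k"
  shows "\<exists>W. elem_word N (real j * (62 * log 2 (2 * real_of_int m))) W \<and>
    (\<forall>p<j. (W * M) $$ (p, k) = 0) \<and> \<bar>(W * M) $$ (k, k)\<bar> \<le> m \<and> (0 < j \<longrightarrow> 0 \<le> (W * M) $$ (k, k)) \<and>
    (\<forall>p<N. \<forall>q<N. j \<le> p \<longrightarrow> p \<noteq> k \<longrightarrow> (W * M) $$ (p, q) = M $$ (p, q)) \<and>
    (\<forall>p\<le>k. \<forall>q<N. k < q \<longrightarrow> (W * M) $$ (p, q) = 0) \<and>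
    entries_le N ((2 * m) ^ j * m) (W * M)"
  using assms(7)
proof (induction j)
  case 0
  have "elem_word N 0 (1\<^sub>m N)"
    using has_word_one[of 0 "SL N"] by simp
  moreover have "1\<^sub>m N * M = M"
    using M by (intro left_mult_one_mat) auto
  ultimately show ?case
    using M(2) m k by (intro exI[of _ "1\<^sub>m N"]) (auto simp: upper_block_def entries_le_def)
next
  case (Suc j)
  then obtain W where W: "elem_word N (real j * (62 * log 2 (2 * real_of_int m))) W"
    and B: "\<And>p. p < j \<Longrightarrow> (W * M) $$ (p, k) = 0" "\<bar>(W * M) $$ (k, k)\<bar> \<le> m"
    "\<And>p q. p < N \<Longrightarrow> q < N \<Longrightarrow> j \<le> p \<Longrightarrow> p \<noteq> k \<Longrightarrow> (W * M) $$ (p, q) = M $$ (p, q)"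
    "\<And>p q. p \<le> k \<Longrightarrow> q < N \<Longrightarrow> k < q \<Longrightarrow> (W * M) $$ (p, q) = 0"
    "entries_le N ((2 * m) ^ j * m) (W * M)"
    by auto
  have Wc: "W \<in> carrier_mat N N" and Mc: "M \<in> carrier_mat N N"
    using elem_word_closed[OF W] M by auto
  define B' where "B' = W * M"
  note B = B[folded B'_def]
  have Bc: "B' \<in> carrier_mat N N"
    using Wc Mc by (simp add: B'_def)
  have j: "j < k" "j < N"
    using Suc.prems k by auto
  have bj: "\<bar>B' $$ (j, k)\<bar> \<le> m"
    using B(3)[of j k] j k m(1) by (auto simp: entries_le_def)
  obtain s t u w where V: "s * B' $$ (k, k) + t * B' $$ (j, k) = gcd (B' $$ (k, k)) (B' $$ (j, k))"
    "u * B' $$ (k, k) + w * B' $$ (j, k) = 0"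
    "\<bar>s\<bar> \<le> m" "\<bar>t\<bar> \<le> m" "\<bar>u\<bar> \<le> m" "\<bar>w\<bar> \<le> m"
    and "elem_act N (62 * log 2 (2 * real_of_int m))
      (\<lambda>v. v(k := s * v k + t * v j, j := u * v k + w * v j))"
    using elem_act_gcd[OF k j(2) _ N B(2) bj m(2)] j by blast
  then obtain E where E: "elem_word N (62 * log 2 (2 * real_of_int m)) E"
    and actE: "act N E = (\<lambda>v. v(k := s * v k + t * v j, j := u * v k + w * v j))"
    by (auto simp: elem_act_def)
  have Ec: "E \<in> carrier_mat N N"
    using elem_word_closed[OF E] by simp
  have EB: "(E * W * M) $$ (p, q) = (if p = j then u * B' $$ (k, q) + w * B' $$ (j, q)
      else if p = k then s * B' $$ (k, q) + t * B' $$ (j, q) else B' $$ (p, q))"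
    if "p < N" "q < N" for p q
    using act_index[OF Ec Bc that] Ec Wc Mc by (simp add: actE B'_def del: index_mult_mat)
  have le: "\<bar>x * B' $$ (k, q) + y * B' $$ (j, q)\<bar> \<le> (2 * m) ^ Suc j * m"
    if xy: "\<bar>x\<bar> \<le> m" "\<bar>y\<bar> \<le> m" and q: "q < N" for x y q
  proof -
    have "\<bar>x * B' $$ (k, q)\<bar> \<le> m * ((2 * m) ^ j * m)" "\<bar>y * B' $$ (j, q)\<bar> \<le> m * ((2 * m) ^ j * m)"
      using B(5) xy q k j m(2) unfolding abs_mult entries_le_def by (intro mult_mono; simp)+
    then show ?thesis
      by (simp add: algebra_simps)
  qed
  have X: "(2 * m) ^ j * m \<le> (2 * m) ^ Suc j * m"
    using m(2) by (intro mult_right_mono power_increasing) auto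
  show ?case
  proof (intro exI[of _ "E * W"] conjI allI impI)
    have "elem_word N (62 * log 2 (2 * real_of_int m) + real j * (62 * log 2 (2 * real_of_int m))) (E * W)"
      by (rule elem_word_mult[OF E W])
    then show "elem_word N (real (Suc j) * (62 * log 2 (2 * real_of_int m))) (E * W)"
      by (simp add: algebra_simps)
  next
    fix p assume "p < Suc j"
    then show "(E * W * M) $$ (p, k) = 0"
      using EB[of p k] V(2) B(1)[of p] j k by (auto simp: less_Suc_eq simp del: index_mult_mat)
  next
    have "(E * W * M) $$ (k, k) = gcd (B' $$ (k, k)) (B' $$ (j, k))"
      using EB[of k k] k j V(1) by (simp del: index_mult_mat)
    then show "\<bar>(E * W * M) $$ (k, k)\<bar> \<le> m" "0 \<le> (E * W * M) $$ (k, k)"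
      using gcd_le_bound[OF B(2) bj] by (simp_all del: index_mult_mat)
  next
    fix p q assume "p < N" "q < N" "Suc j \<le> p" "p \<noteq> k"
    then show "(E * W * M) $$ (p, q) = M $$ (p, q)"
      using EB[of p q] B(3) by (simp del: index_mult_mat)
  next
    fix p q assume "p \<le> k" "q < N" "k < q"
    then show "(E * W * M) $$ (p, q) = 0"
      using EB[of p q] B(4)[of _ q] k j by (simp del: index_mult_mat)
  next
    show "entries_le N ((2 * m) ^ Suc j * m) (E * W * M)"
      unfolding entries_le_def
    proof (intro allI impI)
      fix p q assume pq: "p < N" "q < N"
      then have "\<bar>B' $$ (p, q)\<bar> \<le> (2 * m) ^ Suc j * m"
        using B(5) X unfolding entries_le_def by (meson order.trans)
      then show "\<bar>(E * W * M) $$ (p, q)\<bar> \<le> (2 * m) ^ Suc j * m"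
        using EB[OF pq] le[OF V(3,4) pq(2)] le[OF V(5,6) pq(2)] by (simp del: index_mult_mat power_Suc)
    qed
  qed
qed

section \<open>Clearing a row\<close>

definition row_unipotent :: "nat \<Rightarrow> nat \<Rightarrow> (nat \<Rightarrow> int) \<Rightarrow> int mat" where
  "row_unipotent N k x =
    mat N N (\<lambda>(p, q). (if p = q then 1 else 0) + (if p = k \<and> q < k then x q else 0))"

text \<open>Multiples of the rows \<open>q < k\<close> are added to row \<open>k\<close> one at a
  time; the rows added never change.\<close>

lemma elem_word_row_unipotent:
  assumes N: "N \<ge> 3" and k: "k < N" and x: "\<And>q. q < k \<Longrightarrow> \<bar>x q\<bar> \<le> m" and m: "1 \<le> m"
  shows "elem_word N (real k * (14 * log 2 (2 * real_of_int m))) (row_unipotent N k x)"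
proof (rule elem_act_imp_elem_word)
  have *: "elem_act N (real j * (14 * log 2 (2 * real_of_int m)))
    (\<lambda>v. v(k := v k + (\<Sum>q<j. x q * v q)))" if "j \<le> k" for j
    using that
  proof (induction j)
    case 0
    then show ?case by (simp add: elem_act_id)
  next
    case (Suc j)
    have E: "elem_act N (14 * log 2 (2 * real_of_int m)) (\<lambda>v. v(k := v k + x j * v j))"
      using Suc.prems k x m by (intro elem_act_elementary N) auto
    have "elem_act N (real j * (14 * log 2 (2 * real_of_int m)) + 14 * log 2 (2 * real_of_int m))
      (\<lambda>v. v(k := v k + (\<Sum>q<Suc j. x q * v q)))"
      by (rule elem_act_comp[OF Suc.IH E]) (use Suc.prems in \<open>auto simp: fun_eq_iff\<close>)
    then show ?case
      by (rule elem_act_mono) (simp add: algebra_simps)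
  qed
  have "act N (row_unipotent N k x) = (\<lambda>v. v(k := v k + (\<Sum>q<k. x q * v q)))"
  proof (intro ext)
    fix v p
    have "(\<Sum>r<N. if p = k \<and> r < k then x r * v r else 0) = (if p = k then \<Sum>r<k. x r * v r else 0)"
      using k by (auto intro!: sum.mono_neutral_cong_right split: if_splits)
    moreover have "(\<Sum>r<N. row_unipotent N k x $$ (p, r) * v r) =
        (\<Sum>r<N. (if r = p then v r else 0) + (if p = k \<and> r < k then x r * v r else 0))" if "p < N"
      using that by (intro sum.cong) (auto simp: row_unipotent_def algebra_simps)
    ultimately show "act N (row_unipotent N k x) v p = (v(k := v k + (\<Sum>q<k. x q * v q))) p"
      using k by (auto simp: act_def sum.distrib)
  qed
  with *[OF order_refl] show "elem_act N (real k * (14 * log 2 (2 * real_of_int m))) (act N (row_unipotent N k x))"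
    by simp
qed (simp add: row_unipotent_def)

lemma mult_row_unipotent_index:
  assumes "M \<in> carrier_mat N N" "p < N" "q < N" "k < N"
  shows "(M * row_unipotent N k x) $$ (p, q) = M $$ (p, q) + (if q < k then M $$ (p, k) * x q else 0)"
proof -
  have "(M * row_unipotent N k x) $$ (p, q) = (\<Sum>r<N. M $$ (p, r) * row_unipotent N k x $$ (r, q))"
    using assms by (intro mult_index_sum) (auto simp: row_unipotent_def)
  also have "\<dots> = (\<Sum>r<N. (if r = q then M $$ (p, r) else 0) + (if r = k \<and> q < k then M $$ (p, r) * x q else 0))"
    using assms by (intro sum.cong) (auto simp: row_unipotent_def algebra_simps)
  finally show ?thesis
    using assms by (auto simp: sum.distrib)
qed

text \<open>Such a matrix is diagonal, and its only free entry equals the determinant.\<close>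

lemma upper_block_1:
  assumes M: "M \<in> carrier (SL N)" "upper_block N 1 M" and N: "N \<ge> 1"
  shows "M = 1\<^sub>m N"
proof -
  have Mc: "M \<in> carrier_mat N N" "det M = 1"
    using M by auto
  have "det M = prod_list (diag_mat M)"
    by (rule det_lower_triangular[OF _ Mc(1)]) (use M(2) in \<open>auto simp: upper_block_def\<close>)
  also have "\<dots> = (\<Prod>i<N. M $$ (i, i))"
    using Mc by (simp add: diag_mat_def prod.list_conv_set_nth atLeast0LessThan)
  also have "\<dots> = (\<Prod>i<N. if i = 0 then M $$ (0, 0) else 1)"
    using M(2) by (intro prod.cong) (auto simp: upper_block_def)
  also have "\<dots> = M $$ (0, 0)"
    using N by simp
  finally have "M $$ (0, 0) = 1"
    using Mc by simp
  then have "M $$ (p, q) = (if p = q then 1 else 0)" if "p < N" "q < N" for p q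
    using M(2) that by (cases "p = 0 \<and> q = 0") (auto simp: upper_block_def)
  with Mc show ?thesis
    by (intro eq_matI) auto
qed

text \<open>The summands pay for clearing a column, clearing a row, and the smaller block. Bernoulli
  gives \<open>2 * k^k * (k+1) \<le> (k+1)^(k+1)\<close>; the spare half absorbs the first
  two.\<close>

lemma cost_recursion:
  assumes "k \<ge> 1"
  shows "62 * real k + 14 * real k * real (Suc k) + 186 * real k ^ k * real (Suc k)
    \<le> 186 * real (Suc k) ^ Suc k"
proof -
  have k: "real k \<ge> 1"
    using assms by simp
  have "2 \<le> (1 + 1 / real k) ^ k"
    using Bernoulli_inequality[of "1 / real k" k] k order.trans[of "-1" 0 "1 / real k"] by simp
  then have "2 * real k ^ k \<le> ((1 + 1 / real k) * real k) ^ k"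
    using k by (simp add: power_mult_distrib mult_right_mono)
  also have "(1 + 1 / real k) * real k = real (Suc k)"
    using k by (simp add: field_simps)
  finally have "real (Suc k) * (2 * real k ^ k) \<le> real (Suc k) ^ Suc k"
    by (simp add: mult_left_mono)
  moreover have "real k * real (Suc k) \<le> real k ^ k * real (Suc k)"
    using k assms power_increasing[of 1 k "real k"] by (intro mult_right_mono) auto
  moreover have "real k \<le> real k * real (Suc k)"
    by (simp add: algebra_simps)
  ultimately show ?thesis
    by (simp only: algebra_simps)
qed

text \<open>Induction on the block size: \<open>W\<close> clears column \<open>k\<close>,
  \<open>?F\<close> accounts for row \<open>k\<close>, and \<open>M = W^-1 * M' * ?F\<close> with
  \<open>M'\<close> in the smaller block.\<close>

lemma elem_word_upper_block:
  assumes N: "N \<ge> 3"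
  shows "1 \<le> k \<Longrightarrow> k \<le> N \<Longrightarrow> M \<in> carrier (SL N) \<Longrightarrow> upper_block N k M \<Longrightarrow>
    entries_le N m M \<Longrightarrow> 1 \<le> m \<Longrightarrow> elem_word N (186 * real k ^ k * log 2 (2 * real_of_int m)) M"
proof (induction k arbitrary: M m rule: nat_induct_at_least)
  case base
  then have "M = 1\<^sub>m N"
    using N by (intro upper_block_1) auto
  then show ?case
    using has_word_one[of "186 * real 1 ^ 1 * log 2 (2 * real_of_int m)" "SL N"] base by simp
next
  case (Suc k)
  define T where "T = log 2 (2 * real_of_int m)"
  define m' where "m' = (2 * m) ^ k * m"
  have k: "k < N" "k \<ge> 1"
    using Suc by auto
  obtain W where W: "elem_word N (real k * (62 * T)) W"
    and B: "\<forall>p<k. (W * M) $$ (p, k) = 0" "0 < k \<longrightarrow> 0 \<le> (W * M) $$ (k, k)"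
    "\<forall>p<N. \<forall>q<N. k \<le> p \<longrightarrow> p \<noteq> k \<longrightarrow> (W * M) $$ (p, q) = M $$ (p, q)"
    "\<forall>p\<le>k. \<forall>q<N. k < q \<longrightarrow> (W * M) $$ (p, q) = 0"
    "entries_le N m' (W * M)"
    using clear_column[OF N k(1) Suc.prems(2-5) order_refl] unfolding T_def m'_def by blast
  define B where "B = W * M"
  note B = B[folded B_def]
  have WSL: "W \<in> carrier (SL N)"
    using elem_word_closed[OF W] .
  have BSL: "B \<in> carrier (SL N)"
    using monoid.m_closed[OF group.is_monoid[OF group_SL] WSL Suc.prems(2)] by (simp add: B_def)
  have Bcol: "B $$ (p, k) = 0" if "p < N" "p \<noteq> k" for p
    using B(1,3) Suc.prems(3) that k by (cases "p < k") (auto simp: upper_block_def)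
  \<comment> \<open>Column \<open>k\<close> of \<open>B\<close> vanishes off the diagonal, so the
    pivot divides 1; being nonnegative, it is 1.\<close>
  have Bkk: "B $$ (k, k) = 1"
  proof -
    let ?L = "m_inv (SL N) B"
    have L: "?L \<in> carrier_mat N N" "?L * B = 1\<^sub>m N"
      using group.inv_closed[OF group_SL BSL] group.l_inv[OF group_SL BSL] by auto
    have "1 = (?L * B) $$ (k, k)"
      using k by (simp add: L del: index_mult_mat)
    also have "\<dots> = (\<Sum>r<N. ?L $$ (k, r) * B $$ (r, k))"
      using L BSL k by (intro mult_index_sum) auto
    also have "\<dots> = (\<Sum>r<N. if r = k then ?L $$ (k, k) * B $$ (k, k) else 0)"
      using Bcol by (intro sum.cong) auto
    also have "\<dots> = ?L $$ (k, k) * B $$ (k, k)"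
      using k by simp
    finally have "B $$ (k, k) dvd 1"
      by (metis dvd_triv_right)
    with B(2) k show ?thesis
      by auto
  qed
  let ?F = "row_unipotent N k (\<lambda>q. B $$ (k, q))"
  have m': "1 \<le> m'"
    using mult_mono[of 1 "(2 * m) ^ k" 1 m] one_le_power[of "2 * m" k] Suc.prems(5)
    by (simp add: m'_def)
  have T': "log 2 (2 * real_of_int m') = real (Suc k) * T"
  proof -
    have "2 * real_of_int m' = (2 * real_of_int m) ^ Suc k"
      by (simp add: m'_def)
    then show ?thesis
      using Suc.prems(5) by (simp only: T_def log_nat_power)
  qed
  have F: "elem_word N (real k * (14 * (real (Suc k) * T))) ?F"
    unfolding T'[symmetric]
    using B(5) k m' by (intro elem_word_row_unipotent N) (auto simp: entries_le_def)
  \<comment> \<open>Column \<open>k\<close> of \<open>M'\<close> is a unit vector, so multiplying by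
    \<open>?F\<close> on the right only restores row \<open>k\<close> of \<open>B\<close>.\<close>
  define M' where "M' = mat N N (\<lambda>(p, q). if p = k \<or> q = k then if p = q then 1 else 0 else B $$ (p, q))"
  have M'c: "M' \<in> carrier_mat N N"
    by (simp add: M'_def)
  have eq: "B = M' * ?F"
  proof (rule eq_matI)
    fix p q assume "p < dim_row (M' * ?F)" "q < dim_col (M' * ?F)"
    then have pq: "p < N" "q < N"
      by (auto simp: M'_def row_unipotent_def)
    show "B $$ (p, q) = (M' * ?F) $$ (p, q)"
      unfolding mult_row_unipotent_index[OF M'c pq k(1)]
      using pq k Bcol Bkk B(4) by (auto simp: M'_def)
  qed (use BSL in \<open>auto simp: M'_def row_unipotent_def\<close>)
  have FSL: "?F \<in> carrier (SL N)"
    using elem_word_closed[OF F] .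
  have "det M' = 1"
    using BSL FSL det_mult[OF M'c, of ?F] by (simp add: eq[symmetric])
  then have M'SL: "M' \<in> carrier (SL N)"
    using M'c by simp
  have "upper_block N k M'"
    unfolding upper_block_def
  proof (intro allI impI)
    fix p q assume pq: "p < N" "q < N" "k \<le> p \<or> k \<le> q"
    show "M' $$ (p, q) = (if p = q then 1 else 0)"
    proof (cases "p = k \<or> q = k")
      case False
      with pq consider "k < p" | "p < k" "k < q"
        by linarith
      then show ?thesis
        using B(3,4) Suc.prems(3) pq by cases (auto simp: upper_block_def M'_def)
    qed (use pq in \<open>simp add: M'_def\<close>)
  qed
  moreover have "entries_le N m' M'"
    using B(5) m' by (auto simp: entries_le_def M'_def)
  ultimately have M': "elem_word N (186 * real k ^ k * (real (Suc k) * T)) M'"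
    unfolding T'[symmetric] using M'SL m' k by (intro Suc.IH) auto
  have "M = m_inv (SL N) W * B"
    using group.inv_solve_left[OF group_SL Suc.prems(2) WSL BSL] by (simp add: B_def)
  moreover have "elem_word N (real k * (62 * T) + (186 * real k ^ k * (real (Suc k) * T) + real k * (14 * (real (Suc k) * T))))
      (m_inv (SL N) W * B)"
    by (subst eq, intro elem_word_mult elem_word_inv W M' F)
  ultimately have "elem_word N (real k * (62 * T) + (186 * real k ^ k * (real (Suc k) * T) + real k * (14 * (real (Suc k) * T)))) M"
    by simp
  then show ?case
  proof (rule has_word_mono)
    have "T \<ge> 0"
      using Suc.prems(5) by (simp add: T_def)
    from mult_right_mono[OF cost_recursion[OF k(2)] this]
    show "real k * (62 * T) + (186 * real k ^ k * (real (Suc k) * T) + real k * (14 * (real (Suc k) * T)))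
      \<le> 186 * real (Suc k) ^ Suc k * log 2 (2 * real_of_int m)"
      unfolding T_def[symmetric] by (simp only: algebra_simps)
  qed
qed

section \<open>Bounds on the word length\<close>

lemma sup_norm_iff:
  assumes "M \<in> carrier_mat N N" "N \<ge> 1"
  shows "sup_norm M \<le> m \<longleftrightarrow> entries_le N m M"
proof -
  have "finite (abs ` elements_mat M)"
    by (simp add: elements_mat_def)
  moreover have "M $$ (0, 0) \<in> elements_mat M"
    using assms by (intro elements_matI) auto
  then have "abs ` elements_mat M \<noteq> {}"
    by blast
  ultimately have "sup_norm M \<le> m \<longleftrightarrow> (\<forall>x\<in>elements_mat M. \<bar>x\<bar> \<le> m)"
    by (simp add: sup_norm_def)
  also have "\<dots> \<longleftrightarrow> entries_le N m M"
    using assms(1) by (fastforce simp: entries_le_def)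
  finally show ?thesis .
qed

lemma sup_norm_nonneg:
  fixes M :: "int mat"
  assumes "M \<in> carrier_mat N N" "N \<ge> 1"
  shows "0 \<le> sup_norm M"
proof -
  have "entries_le N (sup_norm M) M"
    using sup_norm_iff[OF assms] by blast
  with assms(2) have "\<bar>M $$ (0, 0)\<bar> \<le> sup_norm M"
    by (simp add: entries_le_def)
  then show ?thesis
    by linarith
qed

lemma elem_word_upper_bound:
  assumes N: "N \<ge> 3" and M: "M \<in> carrier (SL N)"
  shows "elem_word N (372 / ln 2 * real N ^ N * ln (max 2 (real_of_int (sup_norm M)))) M"
proof -
  let ?s = "sup_norm M"
  have "elem_word N (186 * real N ^ N * log 2 (2 * real_of_int (max 1 ?s))) M"
    using N M sup_norm_iff[of M N "max 1 ?s"]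
    by (intro elem_word_upper_block) (auto simp: upper_block_def)
  moreover have "log 2 (2 * real_of_int (max 1 ?s)) \<le> 2 / ln 2 * ln (max 2 (real_of_int ?s))"
  proof -
    \<comment> \<open>Squaring absorbs the factor 2 inside the logarithm, at the price of 372 = 2 *
      186.\<close>
    have "2 * real_of_int (max 1 ?s) \<le> max 2 (real_of_int ?s) * max 2 (real_of_int ?s)"
      by (intro mult_mono) (auto simp: max_def)
    then have "ln (2 * real_of_int (max 1 ?s)) \<le> ln (max 2 (real_of_int ?s) ^ 2)"
      by (subst ln_le_cancel_iff) (auto simp: power2_eq_square)
    also have "\<dots> = 2 * ln (max 2 (real_of_int ?s))"
      by (subst ln_realpow) auto
    finally show ?thesis
      by (simp add: log_def divide_right_mono)
  qed
  then have "186 * real N ^ N * log 2 (2 * real_of_int (max 1 ?s)) \<le>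
      186 * real N ^ N * (2 / ln 2 * ln (max 2 (real_of_int ?s)))"
    by (intro mult_left_mono) auto
  ultimately show ?thesis
    by (elim has_word_mono) (simp add: mult_ac)
qed

text \<open>The entries of a product of \<open>n\<close> letters are at most \<open>c^n\<close>;
  \<open>has_word\<close> ensures that a shortest word exists.\<close>

lemma word_length_lower_bound:
  fixes c :: int
  assumes N: "N \<ge> 1" and X: "X \<subseteq> carrier (SL N)" and c: "c \<ge> 2"
    and step: "\<And>A B m. A \<in> X \<union> m_inv (SL N) ` X \<Longrightarrow> B \<in> carrier (SL N) \<Longrightarrow> entries_le N m B \<Longrightarrow>
      entries_le N (c * m) (A * B)"
    and M: "has_word (SL N) X x M"
  shows "1 / ln c * ln (real_of_int (sup_norm M)) \<le> real (word_length (SL N) X M)"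
proof -
  have *: "entries_le N (c ^ length w) (foldr (*) w (1\<^sub>m N))"
    if "set w \<subseteq> X \<union> m_inv (SL N) ` X" for w
    using that
  proof (induction w)
    case Nil
    then show ?case by (simp add: entries_le_def)
  next
    case (Cons A w)
    have "set w \<subseteq> carrier (SL N)"
      using Cons.prems group.letters_subset[OF group_SL X] by auto
    then have "foldr (*) w (1\<^sub>m N) \<in> carrier (SL N)"
      using group.foldr_mult_closed[OF group_SL] by force
    with Cons step[of A] show ?case
      by simp
  qed
  let ?n = "word_length (SL N) X M"
  obtain w where w: "length w \<le> ?n" "set w \<subseteq> X \<union> m_inv (SL N) ` X" "foldr (*) w (1\<^sub>m N) = M"
    using has_word_word_length[OF M] by (auto simp: has_word_def)
  have Mc: "M \<in> carrier_mat N N"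
    using group.has_word_closed[OF group_SL X M] by simp
  have "sup_norm M \<le> c ^ length w"
    using *[OF w(2)] sup_norm_iff[OF Mc N] w(3) by simp
  also have "\<dots> \<le> c ^ ?n"
    using c w(1) by (intro power_increasing) auto
  finally have s: "real_of_int (sup_norm M) \<le> real_of_int c ^ ?n"
    by (metis of_int_le_iff of_int_power)
  have "ln (real_of_int (sup_norm M)) \<le> real ?n * ln c"
  proof (cases "sup_norm M = 0")
    \<comment> \<open>Here \<open>ln 0 = 0\<close> by convention.\<close>
    case True
    then show ?thesis using c by simp
  next
    case False
    with sup_norm_nonneg[OF Mc N] have "ln (real_of_int (sup_norm M)) \<le> ln (real_of_int c ^ ?n)"
      using s c by (subst ln_le_cancel_iff) auto
    then show ?thesis
      using c by (simp add: ln_realpow)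
  qed
  then show ?thesis
    using c by (simp add: field_simps)
qed

text \<open>Only row \<open>i\<close> changes, to a sum or difference of two rows. The factor 2 does
  not involve \<open>N\<close>, hence neither does \<open>C1\<close>.\<close>

lemma elementary_doubles_entries:
  assumes A: "A \<in> elem_gens N \<union> m_inv (SL N) ` elem_gens N"
    and B: "B \<in> carrier (SL N)" "entries_le N m B"
  shows "entries_le N (2 * m) (A * B)"
proof -
  obtain i j c where A: "A = addrow_mat N c i j" "i < N" "j < N" "i \<noteq> j" "\<bar>c\<bar> = 1"
    using A m_inv_addrow_mat by (fastforce simp: elem_gens_def)
  show ?thesis
    unfolding entries_le_def
  proof (intro allI impI)
    fix p q assume pq: "p < N" "q < N"
    have "(A * B) $$ (p, q) = (if p = i then B $$ (i, q) + c * B $$ (j, q) else B $$ (p, q))"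
      using act_index[of A N B p q] A B pq by (simp add: act_addrow_mat del: index_mult_mat)
    moreover have "\<bar>B $$ (p, q)\<bar> \<le> m" "\<bar>c * B $$ (j, q)\<bar> \<le> m"
      using B(2) pq A by (auto simp: entries_le_def abs_mult)
    ultimately show "\<bar>(A * B) $$ (p, q)\<bar> \<le> 2 * m"
      by (auto simp del: index_mult_mat)
  qed
qed

section \<open>Arbitrary finite generating sets\<close>

lemma entries_le_mult:
  assumes A: "A \<in> carrier_mat N N" "entries_le N K A" and B: "B \<in> carrier_mat N N" "entries_le N m B"
  shows "entries_le N (int N * K * m) (A * B)"
  unfolding entries_le_def
proof (intro allI impI)
  fix p q assume pq: "p < N" "q < N"
  have "\<bar>(A * B) $$ (p, q)\<bar> \<le> (\<Sum>r<N. \<bar>A $$ (p, r) * B $$ (r, q)\<bar>)"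
    unfolding mult_index_sum[OF A(1) B(1) pq] by (rule sum_abs)
  also have "\<dots> \<le> (\<Sum>r<N. K * m)"
    using A(2) B(2) pq unfolding entries_le_def abs_mult
    by (intro sum_mono mult_mono) (auto intro: order.trans[OF abs_ge_zero])
  finally show "\<bar>(A * B) $$ (p, q)\<bar> \<le> int N * K * m"
    by simp
qed

lemma word_length_lower_bound_finite:
  assumes N: "N \<ge> 1" and X: "finite X" "X \<subseteq> carrier (SL N)"
  shows "\<exists>C>0. \<forall>M x. has_word (SL N) X x M \<longrightarrow>
    C * ln (real_of_int (sup_norm M)) \<le> real (word_length (SL N) X M)"
proof -
  let ?Y = "X \<union> m_inv (SL N) ` X"
  \<comment> \<open>Inserting 2 makes the growth factor \<open>N * K\<close> at least 2, so its
    logarithm is positive even if all letters have small norm.\<close>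
  define K where "K = Max (insert 2 (sup_norm ` ?Y))"
  have K: "K \<ge> 2" "\<And>A. A \<in> ?Y \<Longrightarrow> sup_norm A \<le> K"
    using X by (auto simp: K_def intro!: Max_ge)
  have "1 * 2 \<le> int N * K"
    using N K by (intro mult_mono) auto
  then have c: "2 \<le> int N * K"
    by simp
  have Y: "?Y \<subseteq> carrier (SL N)"
    by (rule group.letters_subset[OF group_SL X(2)])
  have "entries_le N (int N * K * m) (A * B)"
    if "A \<in> ?Y" "B \<in> carrier (SL N)" "entries_le N m B" for A B m
  proof -
    have "A \<in> carrier_mat N N"
      using Y that(1) by auto
    then show ?thesis
      using that K(2)[OF that(1)] sup_norm_iff[of A N K] N by (intro entries_le_mult) auto
  qed
  note word_length_lower_bound[OF N X(2) c this]
  moreover have "1 / ln (real_of_int (int N * K)) > 0"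
    using c by (simp del: of_int_mult)
  ultimately show ?thesis
    by blast
qed

text \<open>There are finitely many elementary generators, so the sum of their individual bounds
  serves for all; the added 1 makes it positive.\<close>

lemma has_word_elem_gens_uniform:
  assumes X: "X \<subseteq> carrier (SL N)" "generate (SL N) X = carrier (SL N)"
  shows "\<exists>K>0. \<forall>A\<in>elem_gens N. has_word (SL N) X K A"
proof -
  have "\<forall>A\<in>elem_gens N. \<exists>x. has_word (SL N) X x A"
    using group.has_word_generate[OF group_SL X(1)] elem_gens_subset_SL X(2) by blast
  then obtain f where f: "\<forall>A\<in>elem_gens N. has_word (SL N) X (f A) A"
    by metis
  have "f A \<le> 1 + (\<Sum>A\<in>elem_gens N. \<bar>f A\<bar>)" if "A \<in> elem_gens N" for A
    using member_le_sum[OF that, of "\<lambda>A. \<bar>f A\<bar>"] finite_elem_gens by fastforce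
  with f have "\<forall>A\<in>elem_gens N. has_word (SL N) X (1 + (\<Sum>A\<in>elem_gens N. \<bar>f A\<bar>)) A"
    by (blast intro: has_word_mono)
  moreover have "1 + (\<Sum>A\<in>elem_gens N. \<bar>f A\<bar>) > 0"
    by (simp add: add_pos_nonneg sum_nonneg)
  ultimately show ?thesis
    by blast
qed

theorem theorem4p1:
  shows "(\<forall>N \<ge> 3. \<forall>X. finite X \<and> X \<subseteq> carrier (SL N) \<and> generate (SL N) X = carrier (SL N) \<longrightarrow>
      (\<exists>C1 > 0. \<exists>C2 > 0. \<forall>M \<in> carrier (SL N).
        C1 * ln (real_of_int (sup_norm M)) \<le> real (word_length (SL N) X M) \<and>
        real (word_length (SL N) X M) \<le> C2 * ln (max 2 (real_of_int (sup_norm M))))) \<and>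
    (\<exists>C1 > 0. \<exists>C3 > 0. \<forall>N \<ge> 3. \<exists>C2 > 0. C2 \<le> C3 * real N ^ N \<and>
      (\<forall>M \<in> carrier (SL N).
        C1 * ln (real_of_int (sup_norm M)) \<le> real (word_length (SL N) (elem_gens N) M) \<and>
        real (word_length (SL N) (elem_gens N) M) \<le> C2 * ln (max 2 (real_of_int (sup_norm M)))))"
proof (intro conjI allI impI)
  fix N :: nat and X :: "int mat set"
  assume N: "N \<ge> 3" and "finite X \<and> X \<subseteq> carrier (SL N) \<and> generate (SL N) X = carrier (SL N)"
  then have X: "finite X" "X \<subseteq> carrier (SL N)" "generate (SL N) X = carrier (SL N)"
    by blast+
  obtain K where K: "K > 0" "\<And>A. A \<in> elem_gens N \<Longrightarrow> has_word (SL N) X K A"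
    using has_word_elem_gens_uniform[OF X(2,3)] by blast
  obtain C1 where C1: "C1 > 0" "\<And>M x. has_word (SL N) X x M \<Longrightarrow>
      C1 * ln (real_of_int (sup_norm M)) \<le> real (word_length (SL N) X M)"
    using word_length_lower_bound_finite[OF _ X(1,2)] N by (meson le_trans one_le_numeral)
  let ?C2 = "K * (372 / ln 2 * real N ^ N)"
  have upper: "has_word (SL N) X (?C2 * ln (max 2 (real_of_int (sup_norm M)))) M"
    if "M \<in> carrier (SL N)" for M
    using group.has_word_trans[OF group_SL X(2) K(2) less_imp_le[OF K(1)] elem_word_upper_bound[OF N that]]
    by (simp add: mult.assoc)
  have "?C2 > 0"
    using K N by simp
  with C1 upper word_length_le[OF upper]
  show "\<exists>C1>0. \<exists>C2>0. \<forall>M\<in>carrier (SL N).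
      C1 * ln (real_of_int (sup_norm M)) \<le> real (word_length (SL N) X M) \<and>
      real (word_length (SL N) X M) \<le> C2 * ln (max 2 (real_of_int (sup_norm M)))"
    by blast
next
  let ?C1 = "1 / ln (real_of_int 2)" and ?C3 = "372 / ln 2 :: real"
  have "\<exists>C2 > 0. C2 \<le> ?C3 * real N ^ N \<and>
      (\<forall>M \<in> carrier (SL N).
        ?C1 * ln (real_of_int (sup_norm M)) \<le> real (word_length (SL N) (elem_gens N) M) \<and>
        real (word_length (SL N) (elem_gens N) M) \<le> C2 * ln (max 2 (real_of_int (sup_norm M))))"
    if N: "N \<ge> 3" for N
  proof -
    \<comment> \<open>\<open>C2\<close> is chosen to be \<open>?C3 * real N ^ N\<close>
      itself.\<close>
    have "?C3 * real N ^ N > 0"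
      using N by simp
    moreover have "?C1 * ln (real_of_int (sup_norm M)) \<le> real (word_length (SL N) (elem_gens N) M)"
      if "M \<in> carrier (SL N)" for M
      using N by (intro word_length_lower_bound[OF _ elem_gens_subset_SL _ _ elem_word_upper_bound[OF N that]]
        elementary_doubles_entries) auto
    ultimately show ?thesis
      using word_length_le[OF elem_word_upper_bound[OF N]] by blast
  qed
  moreover have "?C1 > 0" "?C3 > 0"
    by simp_all
  ultimately show "\<exists>C1 > 0. \<exists>C3 > 0. \<forall>N \<ge> 3. \<exists>C2 > 0. C2 \<le> C3 * real N ^ N \<and>
      (\<forall>M \<in> carrier (SL N).
        C1 * ln (real_of_int (sup_norm M)) \<le> real (word_length (SL N) (elem_gens N) M) \<and>
        real (word_length (SL N) (elem_gens N) M) \<le> C2 * ln (max 2 (real_of_int (sup_norm M))))"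
    by blast
qed

end
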